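(* Let $(G,E)$ be a network with correct source holding information $m_0$, with a given set of Byzantine nodes, and let the correct nodes run the broadcast protocol with setting $(H_1,\dots,H_n)$ (all described in the context). Suppose that $\mathrm{Critical}(u)$ is false for every correct node $u$ (see context). Let $\mathcal{R}$ be a reliable node set, and let $v\notin\mathcal{R}$ be a correct node. If there exist - $n$ distinct nodes $r_1,\dots,r_n$ of $\mathcal{R}$, and - $n$ (pairwise) disjoint correct paths $\mathcal{X}_1,\dots,\mathcal{X}_n$ such that, for every $i\in\{1,\dots,n\}$, $\mathcal{X}_i$ is a path of at most $H_i$ hops connecting $v$ and $r_i$, then $\mathcal{R}\cup\{v\}$ is also a reliable node set.
   Context: **Network.** $(G,E)$ is an undirected graph; $G$ is the set of nodes (each with a unique identifier) and $E$ the neighborhood relation. A node can send messages only to its neighbors. Each node is either correct (it follows the protocol) or Byzantine (it behaves arbitrarily, e.g. it may send arbitrary messages to its neighbors at any time). One node, the source, is correct and holds the information $m_0$ to be broadcast (the good information). Communication is asynchronous: every message sent is eventually received, with no bound on the delay; in an infinite execution every process is activated infinitely often, with no assumption on the order of activation. When a node receives a message from a neighbor $q$, it knows that $q$ is the author (a Byzantine node cannot lie about its identity to its direct neighbors). **Protocol.** The setting is a fixed $n$-tuple of integers $(H_1,\dots,H_n)$ known to all correct nodes; $H=\max_i H_i$. Messages have the form $(m,S)$, where $m$ is an information and $S$ is a set of node identifiers. Each correct node has a set $Rec$ (initially empty) of recorded messages. To multicast a message means to send it to all one's neighbors. Initially the source multicasts $(m_0,\emptyset)$. Every other correct node executes: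 1. When a message $(m,S)$ is received from a neighbor $q$: (a) if $q$ is the source, deliver $m$ and multicast $(m,\emptyset)$; (b) if $q\notin S$ and $|S|<H$, add $(m,S\cup\{q\})$ to $Rec$ and multicast $(m,S\cup\{q\})$. 2. When there exist $m,S_1,\dots,S_n$ such that $(m,S_i)\in Rec$ and $|S_i|\le H_i$ for all $i\in\{1,\dots,n\}$, and $S_i\cap S_j=\emptyset$ for all $i\neq j$: deliver $m$ and multicast $(m,\emptyset)$. **Paths.** An $N$-hops path is a sequence of distinct nodes $(p_0,\dots,p_N)$ such that $p_{i-1}$ and $p_i$ are neighbors for all $i\in\{1,\dots,N\}$; it connects $p_0$ and $p_N$. A path is correct if all its nodes are correct. Two paths $(p_0,\dots,p_N)$ and $(p'_0,\dots,p'_{N'})$ are disjoint if $\{p_1,\dots,p_{N-1}\}\cap\{p'_1,\dots,p'_{N'-1}\}=\emptyset$. **Critical nodes.** For a correct node $u$, $\mathrm{Critical}(u)$ is the proposition: there exist $n$ distinct Byzantine nodes $b_1,\dots,b_n$ and $n$ (pairwise) disjoint paths $\mathcal{Y}_1,\dots,\mathcal{Y}_n$ such that, for every $i$, $\mathcal{Y}_i$ is a path of at most $H_i$ hops connecting $u$ and $b_i$. **Reliable node set.** For a given source and a given set of Byzantine nodes, a reliable node set is a set of correct nodes that always deliver the good information $m_0$, in any possible execution. By convention the source itself counts as delivering $m_0$.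
   Formalization: The formal theorem additionally assumes that no endpoint r_j is an interior node of another path X_i (i ≠ j); with disjointness of interiors alone the claim is false. *)

theory Defs
  imports Main "HOL-Library.Multiset"
begin

text \<open>
  Nodes have type \<open>'v\<close> and double as their own identifiers; pieces of information have
  type \<open>'m\<close>. The parameters used throughout are the node set \<open>G\<close>, the neighbourhood
  relation \<open>E\<close>, the set \<open>B\<close> of Byzantine nodes (so \<open>G - B\<close> are the correct ones), the
  source \<open>s\<close>, the good information \<open>m0\<close>, and the setting \<open>(H\<^sub>1,\<dots>,H\<^sub>n)\<close> as a list \<open>hs\<close>,
  with \<open>n = length hs\<close> and indices starting from \<open>0\<close>.
\<close>

subsection \<open>Paths\<close>

definition is_path :: "'v set \<Rightarrow> ('v \<times> 'v) set \<Rightarrow> 'v list \<Rightarrow> bool" where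
  "is_path G E p \<longleftrightarrow> p \<noteq> [] \<and> set p \<subseteq> G \<and> distinct p \<and>
     (\<forall>i. Suc i < length p \<longrightarrow> (p ! i, p ! Suc i) \<in> E)"

definition hops :: "'v list \<Rightarrow> nat" where
  "hops p = length p - 1"

definition interior :: "'v list \<Rightarrow> 'v set" where
  "interior p = set (butlast (tl p))"

definition disjoint_paths :: "'v list \<Rightarrow> 'v list \<Rightarrow> bool" where
  "disjoint_paths p p' \<longleftrightarrow> interior p \<inter> interior p' = {}"

definition connects :: "'v list \<Rightarrow> 'v \<Rightarrow> 'v \<Rightarrow> bool" where
  "connects p x y \<longleftrightarrow> hd p = x \<and> last p = y"

definition critical ::
  "'v set \<Rightarrow> ('v \<times> 'v) set \<Rightarrow> 'v set \<Rightarrow> int list \<Rightarrow> 'v \<Rightarrow> bool" where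
  "critical G E B hs u \<longleftrightarrow>
     (\<exists>(b :: nat \<Rightarrow> 'v) (Y :: nat \<Rightarrow> 'v list).
        inj_on b {..<length hs} \<and>
        (\<forall>i<length hs. b i \<in> B) \<and>
        (\<forall>i<length hs. is_path G E (Y i) \<and> connects (Y i) u (b i) \<and> int (hops (Y i)) \<le> hs ! i) \<and>
        (\<forall>i<length hs. \<forall>j<length hs. i \<noteq> j \<longrightarrow> disjoint_paths (Y i) (Y j)))"

subsection \<open>Protocol\<close>

type_synonym ('v, 'm) msg = "'m \<times> 'v set"

text \<open>
  \<open>transit c q u\<close> contains the messages sent by \<open>q\<close> to \<open>u\<close> and not yet received. Channels
  are multisets, hence there is no order of reception. The components \<open>recs\<close> (the sets
  \<open>Rec\<close>) and \<open>delivered\<close> are meaningful only for correct nodes.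
\<close>

record ('v, 'm) config =
  recs :: "'v \<Rightarrow> ('v, 'm) msg set"
  delivered :: "'v \<Rightarrow> 'm set"
  transit :: "'v \<Rightarrow> 'v \<Rightarrow> ('v, 'm) msg multiset"

definition multicast ::
  "('v \<times> 'v) set \<Rightarrow> 'v \<Rightarrow> ('v, 'm) msg multiset \<Rightarrow> ('v, 'm) config \<Rightarrow> ('v, 'm) config" where
  "multicast E u Ms c =
     c\<lparr>transit := (\<lambda>p q. if p = u \<and> (u, q) \<in> E then transit c p q + Ms else transit c p q)\<rparr>"

definition consume :: "'v \<Rightarrow> 'v \<Rightarrow> ('v, 'm) msg \<Rightarrow> ('v, 'm) config \<Rightarrow> ('v, 'm) config" where
  "consume q u M c =
     c\<lparr>transit := (transit c)(q := (transit c q)(u := transit c q u - {#M#}))\<rparr>"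

definition deliver :: "'v \<Rightarrow> 'm set \<Rightarrow> ('v, 'm) config \<Rightarrow> ('v, 'm) config" where
  "deliver u A c = c\<lparr>delivered := (delivered c)(u := delivered c u \<union> A)\<rparr>"

definition record_msg :: "'v \<Rightarrow> ('v, 'm) msg \<Rightarrow> ('v, 'm) config \<Rightarrow> ('v, 'm) config" where
  "record_msg u M c = c\<lparr>recs := (recs c)(u := insert M (recs c u))\<rparr>"

text \<open>
  Rule 1 at node \<open>u\<close>, for a message \<open>(m, S)\<close> received from \<open>q\<close>. A Byzantine node may send
  an infinite \<open>S\<close>, whose \<open>card\<close> would be \<open>0\<close>; \<open>finite S\<close> makes \<open>|S| < H\<close> fail in that case.
\<close>

definition rule1a ::
  "('v \<times> 'v) set \<Rightarrow> 'v \<Rightarrow> 'v \<Rightarrow> 'v \<Rightarrow> 'm \<Rightarrow> ('v, 'm) config \<Rightarrow> ('v, 'm) config" where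
  "rule1a E s u q m c =
     (if q = s then multicast E u {#(m, {})#} (deliver u {m} c) else c)"

definition rule1b ::
  "('v \<times> 'v) set \<Rightarrow> int list \<Rightarrow> 'v \<Rightarrow> 'v \<Rightarrow> 'm \<Rightarrow> 'v set \<Rightarrow> ('v, 'm) config \<Rightarrow> ('v, 'm) config" where
  "rule1b E hs u q m S c =
     (if q \<notin> S \<and> finite S \<and> int (card S) < Max (set hs)
      then multicast E u {#(m, insert q S)#} (record_msg u (m, insert q S) c) else c)"

definition rule2_guard :: "int list \<Rightarrow> ('v, 'm) msg set \<Rightarrow> 'm \<Rightarrow> bool" where
  "rule2_guard hs Rec m \<longleftrightarrow>
     (\<exists>S :: nat \<Rightarrow> 'v set.
        (\<forall>i<length hs. (m, S i) \<in> Rec \<and> int (card (S i)) \<le> hs ! i) \<and>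
        (\<forall>i<length hs. \<forall>j<length hs. i \<noteq> j \<longrightarrow> S i \<inter> S j = {}))"

text \<open>
  Rule 2 is executed for every \<open>m\<close> satisfying its guard. There are finitely many of them in
  every reachable configuration, as \<open>recs c u\<close> is then finite.
\<close>

definition rule2 ::
  "('v \<times> 'v) set \<Rightarrow> int list \<Rightarrow> 'v \<Rightarrow> ('v, 'm) config \<Rightarrow> ('v, 'm) config" where
  "rule2 E hs u c =
     (let A = {m. rule2_guard hs (recs c u) m}
      in multicast E u (mset_set ((\<lambda>m. (m, {})) ` A)) (deliver u A c))"

subsection \<open>Executions\<close>

definition initial :: "('v \<times> 'v) set \<Rightarrow> 'v \<Rightarrow> 'm \<Rightarrow> ('v, 'm) config" where
  "initial E s m0 = multicast E s {#(m0, {})#}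
     \<lparr>recs = (\<lambda>_. {}), delivered = (\<lambda>_. {}), transit = (\<lambda>_ _. {#})\<rparr>"

text \<open>
  \<open>Receive q u M\<close>: node \<open>u\<close> receives \<open>M\<close> from \<open>q\<close>. \<open>Activate u\<close>: node \<open>u\<close> is activated; this
  has no effect if \<open>u\<close> has nothing to do.
\<close>

datatype ('v, 'm) event =
    Receive 'v 'v "('v, 'm) msg"
  | Activate 'v

text \<open>
  The source does nothing after its initial multicast. An activated Byzantine node sends
  an arbitrary finite multiset \<open>X q\<close> of messages to each of its neighbours \<open>q\<close>.
\<close>

inductive step ::
  "'v set \<Rightarrow> ('v \<times> 'v) set \<Rightarrow> 'v set \<Rightarrow> 'v \<Rightarrow> int list \<Rightarrow>
   ('v, 'm) config \<Rightarrow> ('v, 'm) event \<Rightarrow> ('v, 'm) config \<Rightarrow> bool"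
  for G E B s hs where
  receive_correct:
    "\<lbrakk>u \<in> G - B; u \<noteq> s; (m, S) \<in># transit c q u\<rbrakk> \<Longrightarrow>
     step G E B s hs c (Receive q u (m, S))
       (rule1b E hs u q m S (rule1a E s u q m (consume q u (m, S) c)))"
| receive_other:
    "\<lbrakk>u = s \<or> u \<in> B; M \<in># transit c q u\<rbrakk> \<Longrightarrow>
     step G E B s hs c (Receive q u M) (consume q u M c)"
| activate_correct:
    "\<lbrakk>u \<in> G - B; u \<noteq> s\<rbrakk> \<Longrightarrow> step G E B s hs c (Activate u) (rule2 E hs u c)"
| activate_source:
    "step G E B s hs c (Activate s) c"
| activate_byzantine:
    "\<lbrakk>b \<in> B; \<forall>q. (b, q) \<notin> E \<longrightarrow> X q = {#}\<rbrakk> \<Longrightarrow>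
     step G E B s hs c (Activate b)
       (c\<lparr>transit := (transit c)(b := (\<lambda>q. transit c b q + X q))\<rparr>)"

definition execution ::
  "'v set \<Rightarrow> ('v \<times> 'v) set \<Rightarrow> 'v set \<Rightarrow> 'v \<Rightarrow> 'm \<Rightarrow> int list \<Rightarrow>
   (nat \<Rightarrow> ('v, 'm) config) \<Rightarrow> (nat \<Rightarrow> ('v, 'm) event) \<Rightarrow> bool" where
  "execution G E B s m0 hs c e \<longleftrightarrow>
     c 0 = initial E s m0 \<and>
     (\<forall>t. step G E B s hs (c t) (e t) (c (Suc t))) \<and>
     (\<forall>t q u M. M \<in># transit (c t) q u \<longrightarrow> (\<exists>t'\<ge>t. e t' = Receive q u M)) \<and>
     (\<forall>u\<in>G. \<forall>t. \<exists>t'\<ge>t. e t' = Activate u)"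

definition reliable ::
  "'v set \<Rightarrow> ('v \<times> 'v) set \<Rightarrow> 'v set \<Rightarrow> 'v \<Rightarrow> 'm \<Rightarrow> int list \<Rightarrow> 'v set \<Rightarrow> bool" where
  "reliable G E B s m0 hs R \<longleftrightarrow>
     R \<subseteq> G - B \<and>
     (\<forall>c e. execution G E B s m0 hs c e \<longrightarrow>
        (\<forall>u\<in>R. u = s \<or> (\<exists>t. m0 \<in> delivered (c t) u)))"

end

theory Submission
  imports Defs
begin

text \<open>
  Each \<open>r i\<close> multicasts \<open>(m0, {})\<close>, and the correct nodes of the path \<open>X i\<close> relay it towards
  \<open>v\<close>, which thus records some \<open>(m0, S)\<close> with \<open>S \<subseteq> set (tl (X i))\<close>. An inclusion suffices,
  and equality may fail: the source never relays, so if it lies on the path, the relay starts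
  there. The sets \<open>set (tl (X i))\<close> are pairwise disjoint, hence rule 2 applies at \<open>v\<close>.
\<close>

lemmas protocol_defs =
  multicast_def consume_def deliver_def record_msg_def rule1a_def rule1b_def rule2_def Let_def

text \<open>Since \<open>mset_set\<close> of an infinite set is empty, rule 2 would otherwise multicast nothing.\<close>

lemma finite_rule2_guard:
  assumes "hs \<noteq> []" "finite Rec"
  shows "finite {m. rule2_guard hs Rec m}"
proof (rule finite_subset)
  show "{m. rule2_guard hs Rec m} \<subseteq> fst ` Rec"
    using assms(1) by (force simp: rule2_guard_def)
qed (use assms(2) in simp)

lemma step_recs_mono:
  assumes "step G E B s hs c ev c'"
  shows "recs c u \<subseteq> recs c' u"
  using assms by cases (auto simp: protocol_defs)

lemma step_finite_recs:
  assumes "step G E B s hs c ev c'" "finite (recs c u)"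
  shows "finite (recs c' u)"
  using assms by cases (auto simp: protocol_defs)

text \<open>Only rules 1(a) and 2 deliver, and each multicasts \<open>(m, {})\<close> in the same
  step. The reception is consumed before rule 1(a) multicasts, and a subsequent rule 1(b) only adds
  messages.\<close>

lemma step_deliver_multicasts:
  assumes "step G E B s hs c ev c'" "hs \<noteq> []" "finite (recs c u)"
    and "m \<in> delivered c' u" "m \<notin> delivered c u" "(u, w) \<in> E"
  shows "(m, {}) \<in># transit c' u w"
  using assms(1)
proof cases
  \<comment> \<open>Rule 2 is the one case that relies on finiteness, to find \<open>(m, {})\<close>
    in the \<open>mset_set\<close>.\<close>
  case (activate_correct u')
  then show ?thesis
    using assms finite_rule2_guard[OF assms(2,3)]
    by (auto simp: protocol_defs split: if_splits)
qed (use assms in \<open>auto simp: protocol_defs split: if_splits\<close>)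

text \<open>A multicast is witnessed by messages in transit rather than by an event, since this is
  what the fairness of an execution turns into receptions.\<close>

definition sends ::
  "('v \<times> 'v) set \<Rightarrow> (nat \<Rightarrow> ('v, 'm) config) \<Rightarrow> 'v \<Rightarrow> ('v, 'm) msg \<Rightarrow> bool" where
  "sends E c u M \<longleftrightarrow> (\<exists>t. \<forall>w. (u, w) \<in> E \<longrightarrow> M \<in># transit (c t) u w)"

lemma execution_step:
  "execution G E B s m0 hs c e \<Longrightarrow> step G E B s hs (c t) (e t) (c (Suc t))"
  by (simp add: execution_def)

lemma execution_recs_mono:
  assumes "execution G E B s m0 hs c e" "t \<le> t'"
  shows "recs (c t) u \<subseteq> recs (c t') u"
  using assms(2) by (rule lift_Suc_mono_le[of "\<lambda>t. recs (c t) u", rotated])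
    (rule step_recs_mono[OF execution_step[OF assms(1)]])

lemma execution_finite_recs:
  assumes "execution G E B s m0 hs c e"
  shows "finite (recs (c t) u)"
proof (induction t)
  case 0
  show ?case using assms by (simp add: execution_def initial_def multicast_def)
next
  case (Suc t)
  then show ?case by (rule step_finite_recs[OF execution_step[OF assms]])
qed

lemma source_sends:
  assumes "execution G E B s m0 hs c e"
  shows "sends E c s (m0, {})"
  unfolding sends_def using assms
  by (intro exI[of _ 0]) (simp add: execution_def initial_def multicast_def)

text \<open>The induction goes back to the step at which \<open>m\<close> is first delivered, where
  the multicast occurs.\<close>

lemma delivered_sends:
  assumes "execution G E B s m0 hs c e" "hs \<noteq> []" "m \<in> delivered (c t) u"
  shows "sends E c u (m, {})"
  using assms(3)
proof (induction t)
  case 0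
  then show ?case using assms(1) by (simp add: execution_def initial_def multicast_def)
next
  case (Suc t)
  show ?case
  proof (cases "m \<in> delivered (c t) u")
    case False
    with Suc.prems show ?thesis
      unfolding sends_def
      using step_deliver_multicasts[OF execution_step[OF assms(1)] assms(2)
          execution_finite_recs[OF assms(1)]]
      by blast
  qed (rule Suc.IH)
qed

text \<open>By fairness the message is eventually received, and rule 1(b) then records and
  multicasts in one step.\<close>

lemma sends_relayed:
  assumes ex: "execution G E B s m0 hs c e" and "sends E c q (m, S)" "(q, u) \<in> E"
    and u: "u \<in> G - B" "u \<noteq> s" and S: "q \<notin> S" "finite S" "int (card S) < Max (set hs)"
  shows "\<exists>t. (m, insert q S) \<in> recs (c t) u" and "sends E c u (m, insert q S)"
proof -
  obtain t where "(m, S) \<in># transit (c t) q u"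
    using assms(2,3) by (auto simp: sends_def)
  with ex obtain t' where "e t' = Receive q u (m, S)"
    unfolding execution_def by blast
  then have "step G E B s hs (c t') (Receive q u (m, S)) (c (Suc t'))"
    using execution_step[OF ex, of t'] by simp
  then have c': "c (Suc t') =
      rule1b E hs u q m S (rule1a E s u q m (consume q u (m, S) (c t')))"
    using u by cases auto
  have "(m, insert q S) \<in> recs (c (Suc t')) u"
    using S by (simp add: c' rule1b_def record_msg_def multicast_def)
  then show "\<exists>t. (m, insert q S) \<in> recs (c t) u" ..
  have "\<forall>w. (u, w) \<in> E \<longrightarrow> (m, insert q S) \<in># transit (c (Suc t')) u w"
    using S by (simp add: c' rule1b_def record_msg_def multicast_def)
  then show "sends E c u (m, insert q S)" unfolding sends_def ..
qed

lemma is_path_ConsD: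
  assumes "is_path G E (x # y # p)"
  shows "is_path G E (y # p)" "(x, y) \<in> E" "x \<notin> set (y # p)"
  using assms by (fastforce simp: is_path_def)+

text \<open>Induction from the far end \<open>last (x # p)\<close>, where the information starts,
  back to \<open>x\<close>. The claim on \<open>recs\<close> excludes the far end and the source,
  which need not record anything.\<close>

lemma path_relays:
  assumes ex: "execution G E B s m0 hs c e" and "sym E"
    and "is_path G E (x # p)" "set (x # p) \<subseteq> G - B"
    and "int (length p) \<le> Max (set hs)" "sends E c (last (x # p)) (m0, {})"
  shows "\<exists>S\<subseteq>set p. sends E c x (m0, S) \<and>
    (x \<noteq> s \<and> p \<noteq> [] \<longrightarrow> (\<exists>t. (m0, S) \<in> recs (c t) x))"
  using assms(3-)
proof (induction p arbitrary: x)
  case Nil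
  then show ?case by auto
next
  case (Cons y p)
  show ?case
  proof (cases "x = s")
    case True
    then show ?thesis using source_sends[OF ex] by blast
  next
    case False
    note path = is_path_ConsD[OF Cons.prems(1)]
    obtain S where S: "S \<subseteq> set p" "sends E c y (m0, S)"
      using Cons.IH[of y] Cons.prems path(1) by auto
    \<comment> \<open>The hop from \<open>y\<close> to \<open>x\<close> is not yet counted in
      \<open>S\<close>; this gives the strict bound that rule 1(b) demands.\<close>
    have "card S \<le> length p"
      by (meson S(1) List.finite_set card_length card_mono le_trans)
    then have card: "int (card S) < Max (set hs)" using Cons.prems(3) by simp
    have yx: "(y, x) \<in> E" using path(2) \<open>sym E\<close> by (auto dest: symD)
    have "y \<notin> S" using S(1) path(1) by (auto simp: is_path_def)
    moreover have "finite S" using S(1) finite_subset by blast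
    ultimately have "\<exists>t. (m0, insert y S) \<in> recs (c t) x" "sends E c x (m0, insert y S)"
      using sends_relayed[OF ex S(2) yx _ False] Cons.prems(2) card by auto
    then show ?thesis using S(1) by (intro exI[of _ "insert y S"]) auto
  qed
qed

lemma set_tl_path:
  assumes "connects p x y" "x \<noteq> y" "p \<noteq> []"
  shows "set (tl p) = insert y (interior p)"
proof -
  have "tl p \<noteq> []" using assms by (cases p) (auto simp: connects_def)
  then have "tl p = butlast (tl p) @ [y]"
    using assms by (metis append_butlast_last_id connects_def last_tl)
  then have "set (tl p) = set (butlast (tl p) @ [y])" by simp
  then show ?thesis by (simp add: interior_def)
qed

text \<open>The messages may be recorded at different times, but \<open>recs\<close> never shrinks,
  so any activation after all these times sees them together.\<close>

lemma rule2_guard_delivers: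
  assumes ex: "execution G E B s m0 hs c e" and u: "u \<in> G - B" "u \<noteq> s"
    and rec: "\<forall>i<length hs. (\<exists>t. (m, S i) \<in> recs (c t) u) \<and> int (card (S i)) \<le> hs ! i"
    and disj: "\<forall>i<length hs. \<forall>j<length hs. i \<noteq> j \<longrightarrow> S i \<inter> S j = {}"
  shows "\<exists>t. m \<in> delivered (c t) u"
proof -
  obtain T where T: "\<And>i. i < length hs \<Longrightarrow> (m, S i) \<in> recs (c (T i)) u"
    using rec by metis
  \<comment> \<open>The sum is a convenient common upper bound of the finitely many times
    \<open>T i\<close>.\<close>
  obtain t where t: "t \<ge> (\<Sum>i<length hs. T i)" "e t = Activate u"
    using ex u(1) unfolding execution_def by blast
  have "(m, S i) \<in> recs (c t) u" if "i < length hs" for i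
  proof -
    have "T i \<le> (\<Sum>i<length hs. T i)" using that by (intro member_le_sum) auto
    then show ?thesis
      using T[OF that] t(1) execution_recs_mono[OF ex, of "T i" t u] by auto
  qed
  then have "rule2_guard hs (recs (c t) u) m"
    using rec disj unfolding rule2_guard_def by (intro exI[of _ S]) blast
  moreover have "step G E B s hs (c t) (Activate u) (c (Suc t))"
    using execution_step[OF ex, of t] t(2) by simp
  then have "c (Suc t) = rule2 E hs u (c t)"
    using u by cases auto
  ultimately have "m \<in> delivered (c (Suc t)) u"
    by (simp add: rule2_def Let_def multicast_def deliver_def)
  then show ?thesis ..
qed

theorem theorem2:
  fixes G :: "'v set" and E :: "('v \<times> 'v) set" and B :: "'v set"
    and s :: 'v and m0 :: 'm and hs :: "int list"
    and R :: "'v set" and v :: 'v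
    and r :: "nat \<Rightarrow> 'v" and X :: "nat \<Rightarrow> 'v list"
  assumes "E \<subseteq> G \<times> G" and "sym E"
    and "B \<subseteq> G" and "s \<in> G - B"
    and "hs \<noteq> []"
    and not_critical: "\<forall>u\<in>G - B. \<not> critical G E B hs u"
    and "reliable G E B s m0 hs R"
    and "v \<in> G - B" and "v \<notin> R"
    and "inj_on r {..<length hs}" and "\<forall>i<length hs. r i \<in> R"
    and paths: "\<forall>i<length hs. is_path G E (X i) \<and> set (X i) \<subseteq> G - B \<and>
                  connects (X i) v (r i) \<and> int (hops (X i)) \<le> hs ! i"
    and disjoint: "\<forall>i<length hs. \<forall>j<length hs. i \<noteq> j \<longrightarrow> disjoint_paths (X i) (X j)"
    \<comment> \<open>Disjointness only concerns interior nodes; without the next assumption the claim fails.\<close>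
    and endpoints: "\<forall>i<length hs. \<forall>j<length hs. i \<noteq> j \<longrightarrow> r j \<notin> interior (X i)"
  shows "reliable G E B s m0 hs (R \<union> {v})"
proof -
  let ?n = "length hs"
  have tl_eq: "set (tl (X i)) = insert (r i) (interior (X i))" if "i < ?n" for i
    using that paths \<open>v \<notin> R\<close> \<open>\<forall>i<?n. r i \<in> R\<close>
    by (intro set_tl_path[of _ v]) (auto simp: is_path_def)
  have tl_disj: "set (tl (X i)) \<inter> set (tl (X j)) = {}" if "i < ?n" "j < ?n" "i \<noteq> j" for i j
  proof -
    have "r i \<noteq> r j" using that \<open>inj_on r {..<?n}\<close> by (auto dest: inj_onD)
    then show ?thesis
      using that disjoint endpoints by (auto simp: tl_eq disjoint_paths_def)
  qed
  \<comment> \<open>If \<open>v = s\<close>, reliability holds by convention.\<close>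
  have "\<exists>t. m0 \<in> delivered (c t) v"
    if ex: "execution G E B s m0 hs c e" and "v \<noteq> s" for c e
  proof -
    have "\<exists>S\<subseteq>set (tl (X i)). \<exists>t. (m0, S) \<in> recs (c t) v" if "i < ?n" for i
    proof -
      have p: "is_path G E (X i)" "set (X i) \<subseteq> G - B" "last (X i) = r i"
        using paths that by (auto simp: connects_def)
      have X: "X i = v # tl (X i)"
        using paths that by (cases "X i") (auto simp: is_path_def connects_def)
      have "int (length (tl (X i))) \<le> hs ! i" using paths that by (simp add: hops_def)
      also have "\<dots> \<le> Max (set hs)" using that by simp
      finally have len: "int (length (tl (X i))) \<le> Max (set hs)" .
      have "r i = s \<or> (\<exists>t. m0 \<in> delivered (c t) (r i))"
        using that ex \<open>reliable G E B s m0 hs R\<close> \<open>\<forall>i<?n. r i \<in> R\<close>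
        unfolding reliable_def by blast
      then have "sends E c (last (X i)) (m0, {})"
        using p(3) source_sends[OF ex] delivered_sends[OF ex \<open>hs \<noteq> []\<close>] by auto
      \<comment> \<open>The tail contains \<open>r i\<close>, so \<open>v\<close> is not the far end
        and does record.\<close>
      moreover have "tl (X i) \<noteq> []" using tl_eq[OF that] by auto
      ultimately show ?thesis
        using path_relays[OF ex \<open>sym E\<close>, of v "tl (X i)", folded X] p len \<open>v \<noteq> s\<close> by blast
    qed
    then obtain S where S: "\<And>i. i < ?n \<Longrightarrow> S i \<subseteq> set (tl (X i)) \<and> (\<exists>t. (m0, S i) \<in> recs (c t) v)"
      by metis
    \<comment> \<open>Relaying used the global bound \<open>Max (set hs)\<close>; rule 2 asks for
      the individual one, which the hops of \<open>X i\<close> provide.\<close>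
    have "int (card (S i)) \<le> hs ! i" if "i < ?n" for i
    proof -
      have "card (S i) \<le> length (tl (X i))"
        by (meson S[OF that] List.finite_set card_length card_mono le_trans)
      then show ?thesis using paths that by (fastforce simp: hops_def)
    qed
    moreover have "S i \<inter> S j = {}" if "i < ?n" "j < ?n" "i \<noteq> j" for i j
      using S[OF that(1)] S[OF that(2)] tl_disj[OF that] by blast
    ultimately show ?thesis
      using S by (intro rule2_guard_delivers[OF ex \<open>v \<in> G - B\<close> \<open>v \<noteq> s\<close>, where S = S]) simp_all
  qed
  then show ?thesis
    using \<open>reliable G E B s m0 hs R\<close> \<open>v \<in> G - B\<close>
    unfolding reliable_def by (metis Un_insert_right insert_iff insert_subset sup_bot.right_neutral)
qed

end
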